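(* Let $G\in\mathbb{R}^{N_y\times N_\theta}$ be a matrix, $y\in\mathbb{R}^{N_y}$ a fixed vector, and $\Sigma_\eta\in\mathbb{R}^{N_y\times N_y}$ a symmetric strictly positive definite matrix. Let $m_0\in\mathbb{R}^{N_\theta}$ and assume that the initial covariance matrix $C_0\in\mathbb{R}^{N_\theta\times N_\theta}$ is (symmetric and) strictly positive definite, $C_0\succ 0$. Consider the Kalman inversion iteration with hyperparameters $\Sigma_\nu=2\Sigma_\eta$ and $\Sigma_\omega=C_n$ at the $n$-th iteration, namely, for $n\ge 0$, $$\widehat{C}_{n+1}=C_n+\Sigma_\omega=2C_n,$$ $$m_{n+1}=m_n+\widehat{C}_{n+1}G^T\big(G\widehat{C}_{n+1}G^T+\Sigma_\nu\big)^{-1}(y-Gm_n),$$ $$C_{n+1}=\widehat{C}_{n+1}-\widehat{C}_{n+1}G^T\big(G\widehat{C}_{n+1}G^T+\Sigma_\nu\big)^{-1}G\widehat{C}_{n+1}.$$ Then the iteration for the conditional mean $m_n$ and the precision matrix $C_n^{-1}$ (which characterize the distribution of $\theta_n|Y_n$) converges exponentially fast to a limit $m_\infty$, $C_\infty^{-1}$. Furthermore, the limiting mean $m_\infty$ is a minimizer over $\theta\in\mathbb{R}^{N_\theta}$ of the unregularized least squares functional $$\Phi(\theta,y)=\tfrac12\big\|\Sigma_\eta^{-1/2}(y-G\theta)\big\|^2,$$ and the limiting precision matrix is $C_\infty^{-1}=G^T\Sigma_\eta^{-1}G$, which is the posterior precision matrix with an uninformative prior.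
   Context: The linear inverse problem is to recover $\theta\in\mathbb{R}^{N_\theta}$ from $y=G\theta+\eta$ with $\eta\sim\mathcal{N}(0,\Sigma_\eta)$. It is paired with the stochastic dynamical system $\theta_{n+1}=\theta_n+\omega_{n+1}$, $\omega_{n+1}\sim\mathcal{N}(0,\Sigma_\omega)$, and $y_{n+1}=G\theta_{n+1}+\nu_{n+1}$, $\nu_{n+1}\sim\mathcal{N}(0,\Sigma_\nu)$, where the artificial errors are mutually independent zero-mean Gaussian sequences and the observation is $y_{n+1}=y$ for every $n$. Here $Y_n=\{y_1,\dots,y_n\}$, and $\mathcal{N}(m_n,C_n)$ is the distribution of $\theta_n|Y_n$ when $\theta_0\sim\mathcal{N}(m_0,C_0)$; the recursion in the claim is the Kalman filter update for this system. The matrix $G$ is not assumed to have trivial null space, so $C_\infty^{-1}$ denotes the limit of the matrices $C_n^{-1}$ and may be singular. The posterior with an uninformative (improper uniform) prior is the (possibly improper) density proportional to $e^{-\Phi(\theta,y)}$; its precision matrix is the matrix of the quadratic part of $2\Phi(\cdot,y)$, i.e. $G^T\Sigma_\eta^{-1}G$. *)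

theory Defs
  imports "HOL-Analysis.Analysis"
begin

definition sym_pos_def :: "real^'k^'k \<Rightarrow> bool" where
  "sym_pos_def A \<longleftrightarrow> transpose A = A \<and> (\<forall>x. x \<noteq> 0 \<longrightarrow> x \<bullet> (A *v x) > 0)"

(* The principal square root: a symmetric positive definite matrix has exactly one symmetric
   positive definite square root. On other matrices the value is unspecified. *)
definition matrix_sqrt :: "real^'k^'k \<Rightarrow> real^'k^'k" where
  "matrix_sqrt A = (THE S. sym_pos_def S \<and> S ** S = A)"

definition least_squares ::
  "real^'n^'m \<Rightarrow> real^'m^'m \<Rightarrow> real^'n \<Rightarrow> real^'m \<Rightarrow> real" where
  "least_squares G \<Sigma> \<theta> y =
     1/2 * (norm (matrix_inv (matrix_sqrt \<Sigma>) *v (y - G *v \<theta>)))\<^sup>2"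

definition uninformative_posterior ::
  "real^'n^'m \<Rightarrow> real^'m^'m \<Rightarrow> real^'m \<Rightarrow> real^'n \<Rightarrow> real" where
  "uninformative_posterior G \<Sigma> y \<theta> = exp (- least_squares G \<Sigma> \<theta> y)"

(* For a possibly improper Gaussian density p, P is the symmetric matrix of the quadratic part of
   -2 ln p. The free additive constant c makes this insensitive to normalization, so p need only
   be given up to a positive factor and need not be integrable; P may be singular. *)
definition is_precision_matrix :: "(real^'n \<Rightarrow> real) \<Rightarrow> real^'n^'n \<Rightarrow> bool" where
  "is_precision_matrix p P \<longleftrightarrow> transpose P = P \<and>
     (\<exists>b c. \<forall>\<theta>. p \<theta> > 0 \<and> - 2 * ln (p \<theta>) = \<theta> \<bullet> (P *v \<theta>) + b \<bullet> \<theta> + c)"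

definition converges_exponentially :: "(nat \<Rightarrow> 'a::real_normed_vector) \<Rightarrow> 'a \<Rightarrow> bool" where
  "converges_exponentially X L \<longleftrightarrow>
     (\<exists>K r. 0 < r \<and> r < 1 \<and> (\<forall>n. norm (X n - L) \<le> K * r ^ n))"

end

theory Submission
  imports Defs
begin

text \<open>By the Woodbury identity the precision \<open>P\<^sub>n = C\<^sub>n\<^sup>-\<^sup>1\<close> satisfies \<open>P\<^sub>n\<^sub>+\<^sub>1 = (P\<^sub>n + H) / 2\<close>
  with \<open>H = G\<^sup>T \<Sigma>\<^sub>\<eta>\<^sup>-\<^sup>1 G\<close>, so \<open>P\<^sub>n - H\<close> is halved in every step. For a solution \<open>m\<^sub>\<infinity>\<close> of the normal
  equations the error \<open>m\<^sub>n - m\<^sub>\<infinity>\<close>, weighted by \<open>P\<^sub>n\<close>, is halved as well. As \<open>H\<close> may be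
  singular, this alone does not give decay; choosing \<open>m\<^sub>\<infinity>\<close> with \<open>P\<^sub>0 (m\<^sub>0 - m\<^sub>\<infinity>) = - H w\<close> in the range
  of \<open>H\<close> gives \<open>P\<^sub>n (m\<^sub>n - m\<^sub>\<infinity> + 2\<^sup>-\<^sup>n w) = 4\<^sup>-\<^sup>n (P\<^sub>0 - H) w\<close>, and \<open>P\<^sub>n \<ge> 2\<^sup>-\<^sup>n P\<^sub>0\<close> yields
  \<open>m\<^sub>n - m\<^sub>\<infinity> = O(2\<^sup>-\<^sup>n)\<close>.\<close>

section \<open>Matrix inverses, positive definite matrices and congruences\<close>

lemma inner_matrix_vector_mult:
  fixes A :: "real^'n^'m"
  shows "x \<bullet> (A *v z) = (transpose A *v x) \<bullet> z"
  by (simp add: dot_lmul_matrix)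

lemma transpose_add: "transpose (A + B) = transpose A + transpose B"
  by (simp add: transpose_def vec_eq_iff)

lemma scaleR_matrix_vector_mult:
  fixes A :: "real^'n^'m"
  shows "(k *\<^sub>R A) *v x = k *\<^sub>R (A *v x)"
  by (simp add: scaleR_matrix_vector_assoc)

lemma matrix_inv_mult:
  fixes A :: "real^'k^'k"
  assumes "invertible A"
  shows "A ** matrix_inv A = mat 1" "matrix_inv A ** A = mat 1"
  using assms unfolding invertible_def matrix_inv_def by (metis (mono_tags, lifting) someI_ex)+

lemma matrix_inv_mult_vec:
  fixes A :: "real^'k^'k"
  assumes "invertible A"
  shows "A *v (matrix_inv A *v x) = x" "matrix_inv A *v (A *v x) = x"
  by (simp_all add: matrix_vector_mul_assoc matrix_inv_mult[OF assms])

text \<open>For square matrices a left inverse is two-sided, so the value chosen by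
  \<open>matrix_inv\<close> can only be \<open>B\<close>.\<close>

lemma matrix_inv_unique:
  fixes A :: "real^'k^'k"
  assumes "B ** A = mat 1"
  shows "matrix_inv A = B"
proof -
  have "invertible A"
    using assms invertible_left_inverse by blast
  then show ?thesis
    by (metis assms matrix_inv_mult(1) matrix_mul_assoc matrix_mul_lid matrix_mul_rid)
qed

lemma sym_pos_defD:
  assumes "sym_pos_def A"
  shows "transpose A = A" "x \<noteq> 0 \<Longrightarrow> 0 < x \<bullet> (A *v x)" "0 \<le> x \<bullet> (A *v x)"
    "x \<bullet> (A *v x) \<le> 0 \<Longrightarrow> x = 0" "x \<bullet> (A *v z) = (A *v x) \<bullet> z"
  using assms unfolding sym_pos_def_def
  by (force simp del: transpose_matrix_vector simp: inner_matrix_vector_mult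
      dest: spec[of _ x] intro: less_imp_le)+

lemma sym_pos_def_invertible:
  assumes "sym_pos_def A"
  shows "invertible A"
proof -
  have "\<forall>x. A *v x = 0 \<longrightarrow> x = 0"
    using sym_pos_defD(4)[OF assms] by auto
  then show ?thesis
    using matrix_left_invertible_ker[of A] invertible_left_inverse by blast
qed

lemma sym_pos_def_matrix_inv:
  assumes A: "sym_pos_def A"
  shows "sym_pos_def (matrix_inv A)"
proof -
  note inv = sym_pos_def_invertible[OF A]
  have "transpose (matrix_inv A) ** A = mat 1"
    by (metis matrix_inv_mult(1)[OF inv] matrix_transpose_mul sym_pos_defD(1)[OF A] transpose_mat)
  then have t: "transpose (matrix_inv A) = matrix_inv A"
    using matrix_inv_unique by metis
  have "0 < x \<bullet> (matrix_inv A *v x)" if "x \<noteq> 0" for x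
  proof -
    have "matrix_inv A *v x \<noteq> 0"
      using that matrix_inv_mult_vec(1)[OF inv, of x] by auto
    from sym_pos_defD(2)[OF A this] show ?thesis
      by (simp add: matrix_inv_mult_vec[OF inv] inner_commute)
  qed
  with t show ?thesis
    by (simp add: sym_pos_def_def)
qed

lemma sym_pos_def_scaleR:
  assumes "sym_pos_def A" "0 < k"
  shows "sym_pos_def (k *\<^sub>R A)"
  using assms by (simp add: sym_pos_def_def transpose_scalar scaleR_matrix_vector_mult)

lemma matrix_inv_scaleR:
  fixes A :: "real^'k^'k"
  assumes "invertible A" "k \<noteq> 0"
  shows "matrix_inv (k *\<^sub>R A) = (1 / k) *\<^sub>R matrix_inv A"
  using assms
  by (intro matrix_inv_unique)
    (simp add: scalar_matrix_assoc[symmetric] matrix_scalar_ac matrix_inv_mult)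

lemma sym_pos_def_add:
  assumes "sym_pos_def A" "transpose B = B" "\<And>x. 0 \<le> x \<bullet> (B *v x)"
  shows "sym_pos_def (A + B)"
  using assms
  by (auto simp: sym_pos_def_def transpose_add algebra_simps intro: add_pos_nonneg)

text \<open>The form of the congruent matrix at \<open>x\<close> is the form of \<open>D\<close> at
  \<open>B *v x\<close>, hence it vanishes only on the kernel of \<open>B\<close>. Nothing is
  assumed about that kernel, so a singular \<open>G\<close> is covered.\<close>

lemma sym_pos_def_congruence:
  fixes B :: "real^'n^'m"
  assumes D: "sym_pos_def D"
  shows "transpose (transpose B ** D ** B) = transpose B ** D ** B"
    and "x \<bullet> ((transpose B ** D ** B) *v z) = (B *v x) \<bullet> (D *v (B *v z))"
    and "0 \<le> x \<bullet> ((transpose B ** D ** B) *v x)"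
    and "x \<bullet> ((transpose B ** D ** B) *v x) \<le> 0 \<Longrightarrow> B *v x = 0"
proof -
  show t: "transpose (transpose B ** D ** B) = transpose B ** D ** B"
    by (simp add: matrix_transpose_mul matrix_mul_assoc sym_pos_defD(1)[OF D])
  show e: "x \<bullet> ((transpose B ** D ** B) *v z) = (B *v x) \<bullet> (D *v (B *v z))" for x z
    by (simp add: inner_matrix_vector_mult matrix_vector_mul_assoc[symmetric]
        del: transpose_matrix_vector)
  show "0 \<le> x \<bullet> ((transpose B ** D ** B) *v x)"
    by (simp add: e sym_pos_defD(3)[OF D])
  show "x \<bullet> ((transpose B ** D ** B) *v x) \<le> 0 \<Longrightarrow> B *v x = 0"
    using sym_pos_defD(4)[OF D] by (simp add: e)
qed

text \<open>The kernel of \<open>transpose B ** D ** B\<close> lies in the kernel of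
  \<open>B\<close>, which is orthogonal to the range of \<open>transpose B\<close>. The matrix is
  thus injective on that range and maps it into itself; counting dimensions gives equality. This
  makes the normal equations solvable even when \<open>H\<close> is singular.\<close>

lemma range_congruence:
  fixes B :: "real^'n^'m"
  assumes D: "sym_pos_def D"
  shows "range ((*v) (transpose B ** D ** B)) = range ((*v) (transpose B))" (is "range ?f = ?V")
proof -
  have lin: "linear ?f"
    by (simp add: matrix_vector_mul_linear)
  have V: "subspace ?V"
    by (intro linear_subspace_image) (auto simp: matrix_vector_mul_linear)
  have "inj_on ?f (span ?V)"
    unfolding linear_inj_on_iff_eq_0[OF lin subspace_span]
  proof clarify
    fix x assume "x \<in> span ?V" and 0: "?f x = 0"
    then obtain z where z: "x = transpose B *v z"
      using V by (auto simp: span_eq_iff[THEN iffD2])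
    have "B *v x = 0"
      using sym_pos_def_congruence(4)[OF D, of x B] 0 by simp
    then have "x \<bullet> x = 0"
      by (metis z inner_matrix_vector_mult inner_zero_left transpose_transpose)
    then show "x = 0" by simp
  qed
  then have dim: "dim (?f ` ?V) = dim ?V"
    by (rule dim_image_eq[OF lin])
  have 1: "?f ` ?V \<subseteq> ?V" "range ?f \<subseteq> ?V"
    by (auto simp: matrix_vector_mul_assoc[symmetric] simp del: transpose_matrix_vector)
  have "?f ` ?V = ?V"
    using 1(1) dim by (intro subspace_dim_equal V linear_subspace_image lin) auto
  with 1 show ?thesis by blast
qed

text \<open>The constant is the minimum of the quadratic form on the compact unit sphere;
  homogeneity extends the bound to all vectors.\<close>

lemma sym_pos_def_coercive:
  fixes A :: "real^'k^'k"
  assumes "sym_pos_def A"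
  obtains c where "0 < c" "\<And>x. c * (norm x)\<^sup>2 \<le> x \<bullet> (A *v x)"
proof -
  let ?S = "sphere 0 1 :: (real^'k) set"
  have "continuous_on ?S (\<lambda>x. x \<bullet> (A *v x))"
    by (intro continuous_intros linear_continuous_on matrix_vector_mul_bounded_linear)
  moreover have "?S \<noteq> {}" by (simp)
  ultimately obtain u where u: "u \<in> ?S" "\<And>x. x \<in> ?S \<Longrightarrow> u \<bullet> (A *v u) \<le> x \<bullet> (A *v x)"
    using continuous_attains_inf[OF compact_sphere] by blast
  show thesis
  proof (rule that)
    show "0 < u \<bullet> (A *v u)"
      using u(1) by (intro sym_pos_defD(2)[OF assms]) auto
    show "u \<bullet> (A *v u) * (norm x)\<^sup>2 \<le> x \<bullet> (A *v x)" for x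
    proof (cases "x = 0")
      case False
      have "u \<bullet> (A *v u) \<le> (x /\<^sub>R norm x) \<bullet> (A *v (x /\<^sub>R norm x))"
        using False by (intro u(2)) simp
      also have "\<dots> = x \<bullet> (A *v x) / (norm x)\<^sup>2"
        by (simp add: matrix_vector_mult_scaleR power2_eq_square divide_simps)
      finally show ?thesis
        using False by (simp add: field_simps)
    qed simp
  qed
qed

section \<open>Existence and uniqueness of the positive definite square root\<close>

text \<open>\<open>I - Z\<close> is a square root of \<open>I - B\<close>; \<open>Z\<close> is the fixed point of \<open>Z \<mapsto> (B + Z\<^sup>2) / 2\<close>, which is
  a contraction on the ball whose radius solves the scalar equation \<open>\<parallel>B\<parallel> + r\<^sup>2 = 2 r\<close>.\<close>

lemma sqrt_near_identity:
  fixes B :: "'a::euclidean_space \<Rightarrow>\<^sub>L 'a"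
  assumes b: "norm B < 1" and sa: "\<And>x z. x \<bullet> blinfun_apply B z = blinfun_apply B x \<bullet> z"
  obtains Z :: "'a \<Rightarrow>\<^sub>L 'a" where "norm Z < 1" "2 *\<^sub>R Z = B + (Z o\<^sub>L Z)"
    "\<And>x z. x \<bullet> blinfun_apply Z z = blinfun_apply Z x \<bullet> z"
proof -
  define r where "r = 1 - sqrt (1 - norm B)"
  have r: "0 \<le> r" "r < 1" "norm B + r * r = 2 * r"
    using b by (auto simp: r_def algebra_simps)
  \<comment> \<open>Self-adjointness is a closed condition preserved by \<open>f\<close>; building
    it into the complete set \<open>S\<close> passes it on to the fixed point.\<close>
  define S where "S = {Z :: 'a \<Rightarrow>\<^sub>L 'a. norm Z \<le> r \<and>
    (\<forall>x z. x \<bullet> blinfun_apply Z z = blinfun_apply Z x \<bullet> z)}"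
  define f where "f = (\<lambda>Z. (1/2) *\<^sub>R (B + (Z o\<^sub>L Z)))"
  have "S = cball 0 r \<inter> (\<Inter>x. \<Inter>z. {Z. x \<bullet> blinfun_apply Z z = blinfun_apply Z x \<bullet> z})"
    by (auto simp: S_def)
  moreover have "closed {Z :: 'a \<Rightarrow>\<^sub>L 'a. x \<bullet> blinfun_apply Z z = blinfun_apply Z x \<bullet> z}" for x z
    by (intro closed_Collect_eq continuous_intros)
  ultimately have "closed S"
    by (simp only: closed_Int closed_cball closed_INT ball_UNIV simp_thms)
  then have "complete S" by (simp add: complete_eq_closed)
  moreover have "0 \<in> S" using r by (simp add: S_def)
  moreover have "f ` S \<subseteq> S"
  proof clarify
    fix Z assume Z: "Z \<in> S"
    have "norm (Z o\<^sub>L Z) \<le> r * r"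
      using norm_blinfun_compose[of Z Z] mult_mono[of "norm Z" r "norm Z" r] Z r
      by (simp add: S_def)
    then have "norm (f Z) \<le> r"
      using norm_triangle_ineq[of B "Z o\<^sub>L Z"] r(3) by (simp add: f_def)
    moreover have "x \<bullet> blinfun_apply (f Z) z = blinfun_apply (f Z) x \<bullet> z" for x z
      using Z by (simp add: f_def S_def sa blinfun.bilinear_simps inner_simps)
    ultimately show "f Z \<in> S" by (simp add: S_def)
  qed
  moreover have "dist (f Y) (f Z) \<le> r * dist Y Z" if "Y \<in> S" "Z \<in> S" for Y Z
  proof -
    interpret c: bounded_bilinear "(o\<^sub>L) :: ('a \<Rightarrow>\<^sub>L 'a) \<Rightarrow> ('a \<Rightarrow>\<^sub>L 'a) \<Rightarrow> ('a \<Rightarrow>\<^sub>L 'a)"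
      by (rule bounded_bilinear_blinfun_compose)
    \<comment> \<open>This splitting of \<open>Y^2 - Z^2\<close> holds without commutativity. Each
      summand contributes a factor \<open>r\<close>, and the factor 1/2 turns the sum into the
      contraction constant \<open>r < 1\<close>.\<close>
    have "f Y - f Z = (1/2) *\<^sub>R ((Y o\<^sub>L (Y - Z)) + ((Y - Z) o\<^sub>L Z))"
      by (simp add: f_def c.diff_left c.diff_right algebra_simps)
    then have "norm (f Y - f Z) \<le> 1/2 * (norm (Y o\<^sub>L (Y - Z)) + norm ((Y - Z) o\<^sub>L Z))"
      by (simp add: norm_triangle_ineq)
    also have "\<dots> \<le> 1/2 * (norm Y * norm (Y - Z) + norm (Y - Z) * norm Z)"
      by (intro mult_left_mono add_mono norm_blinfun_compose) auto
    also have "\<dots> \<le> 1/2 * (r * norm (Y - Z) + norm (Y - Z) * r)"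
      using that by (intro mult_left_mono add_mono mult_mono) (auto simp: S_def r)
    finally show ?thesis by (simp add: dist_norm mult.commute)
  qed
  ultimately obtain Z where Z: "Z \<in> S" "f Z = Z"
    using Banach_fix[of S r f] r by blast
  show thesis
  proof (rule that)
    show "norm Z < 1" using Z(1) r by (simp add: S_def)
    have "2 *\<^sub>R Z = 2 *\<^sub>R f Z" by (simp add: Z(2))
    then show "2 *\<^sub>R Z = B + (Z o\<^sub>L Z)" by (simp add: f_def)
    show "\<And>x z. x \<bullet> blinfun_apply Z z = blinfun_apply Z x \<bullet> z" using Z(1) by (simp add: S_def)
  qed
qed

text \<open>For a suitable scale \<open>c\<close> the operator \<open>B = I - c A\<close> has norm
  below 1, so \<open>sqrt_near_identity\<close> gives a root \<open>I - Z\<close> of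
  \<open>c A\<close>; dividing by \<open>sqrt c\<close> undoes the scaling.\<close>

lemma sym_pos_def_sqrt_exists:
  fixes A :: "real^'k^'k"
  assumes A: "sym_pos_def A"
  obtains S where "sym_pos_def S" "S ** S = A"
proof -
  obtain a where a: "0 < a" "\<And>x. a * (norm x)\<^sup>2 \<le> x \<bullet> (A *v x)"
    using sym_pos_def_coercive[OF A] by metis
  obtain M where M: "0 < M" "\<And>x. norm (A *v x) \<le> norm x * M"
    using bounded_linear.pos_bounded[OF matrix_vector_mul_bounded_linear[of A]] by metis
  \<comment> \<open>The scale \<open>c\<close> makes \<open>I - c A\<close> a contraction: it minimizes \<open>1 - 2 c a + c\<^sup>2 M\<^sup>2\<close>.\<close>
  define c where "c = a / M\<^sup>2"
  have c: "0 < c" using a M by (simp add: c_def)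
  \<comment> \<open>\<open>q\<close> bounds the squared operator norm of \<open>B\<close>; the
    maximum with 0 gives nonnegativity without comparing \<open>a\<close> and
    \<open>M\<close>.\<close>
  define q where "q = max 0 (1 - a * c)"
  have q: "0 \<le> q" "q < 1" using a(1) c by (auto simp: q_def)
  define B where "B = Blinfun (\<lambda>x. x - c *\<^sub>R (A *v x))"
  have B: "blinfun_apply B x = x - c *\<^sub>R (A *v x)" for x
    unfolding B_def
    by (subst bounded_linear_Blinfun_apply)
      (auto intro!: bounded_linear_intros matrix_vector_mul_bounded_linear)
  have "norm (blinfun_apply B x) \<le> sqrt q * norm x" for x
  proof -
    have "(norm (blinfun_apply B x))\<^sup>2
        = (norm x)\<^sup>2 - 2 * c * (x \<bullet> (A *v x)) + c\<^sup>2 * (norm (A *v x))\<^sup>2"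
      unfolding B power2_norm_eq_inner
      by (simp add: inner_simps inner_commute power2_eq_square algebra_simps)
    also have "\<dots> \<le> (norm x)\<^sup>2 - 2 * c * (a * (norm x)\<^sup>2) + c\<^sup>2 * (norm x * M)\<^sup>2"
      using a(2)[of x] M(2)[of x] c by (intro add_mono diff_mono mult_left_mono power_mono) auto
    also have "\<dots> = (1 - a * c) * (norm x)\<^sup>2"
      using M(1) by (simp add: c_def field_simps power2_eq_square)
    also have "\<dots> \<le> q * (norm x)\<^sup>2"
      by (intro mult_right_mono) (auto simp: q_def)
    finally have "(norm (blinfun_apply B x))\<^sup>2 \<le> (sqrt q * norm x)\<^sup>2"
      using q by (simp add: power_mult_distrib)
    then show ?thesis
      using q by (auto intro: power2_le_imp_le)
  qed
  then have "norm B \<le> sqrt q"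
    using q by (intro norm_blinfun_bound) auto
  then have nB: "norm B < 1"
    using q by (auto intro: le_less_trans)
  have "x \<bullet> blinfun_apply B z = blinfun_apply B x \<bullet> z" for x z
    by (simp add: B inner_simps sym_pos_defD(5)[OF A])
  then obtain Z where Z: "norm Z < 1" "2 *\<^sub>R Z = B + (Z o\<^sub>L Z)"
    "\<And>x z. x \<bullet> blinfun_apply Z z = blinfun_apply Z x \<bullet> z"
    using sqrt_near_identity[OF nB] by blast
  define S where "S = matrix (\<lambda>x. (1 / sqrt c) *\<^sub>R (x - blinfun_apply Z x))"
  have S: "S *v x = (1 / sqrt c) *\<^sub>R (x - blinfun_apply Z x)" for x
    unfolding S_def
    by (rule fun_cong[OF matrix_vector_mul(3)])
      (intro bounded_linear_const_scaleR bounded_linear_sub bounded_linear_ident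
        blinfun.bounded_linear_right)
  show thesis
  proof (rule that)
    have "0 < x \<bullet> (S *v x)" if "x \<noteq> 0" for x
    proof -
      have "x \<bullet> blinfun_apply Z x \<le> norm x * (norm Z * norm x)"
        using norm_cauchy_schwarz[of x "blinfun_apply Z x"]
          mult_left_mono[OF norm_blinfun[of Z x] norm_ge_zero[of x]] by linarith
      also have "\<dots> < norm x * (1 * norm x)"
        using that Z(1) by (intro mult_strict_left_mono mult_strict_right_mono) auto
      finally show ?thesis
        using c by (simp add: S inner_simps dot_square_norm power2_eq_square)
    qed
    moreover have "transpose S = S"
    proof -
      have "(transpose S *v x) \<bullet> z = (S *v x) \<bullet> z" for x z
        unfolding inner_matrix_vector_mult[symmetric] by (simp add: S inner_simps Z(3))
      then have "transpose S *v x = S *v x" for x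
        by (metis vector_eq_rdot)
      then show ?thesis by (simp add: matrix_eq del: transpose_matrix_vector)
    qed
    ultimately show "sym_pos_def S" by (simp add: sym_pos_def_def)
    have "S *v (S *v x) = A *v x" for x
    proof -
      \<comment> \<open>In \<open>I - 2 Z + Z^2\<close> the fixed-point equation replaces
        \<open>2 Z\<close> by \<open>B + Z^2\<close>, which leaves
        \<open>I - B = c A\<close>.\<close>
      have "S *v (S *v x) = (1 / c) *\<^sub>R
          (x - 2 *\<^sub>R blinfun_apply Z x + blinfun_apply Z (blinfun_apply Z x))"
        using c by (simp add: S blinfun.bilinear_simps algebra_simps scaleR_2)
      also have "2 *\<^sub>R blinfun_apply Z x = blinfun_apply B x + blinfun_apply Z (blinfun_apply Z x)"
        using arg_cong[OF Z(2), of "\<lambda>F. blinfun_apply F x"] by (simp add: blinfun.bilinear_simps)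
      finally show ?thesis using c by (simp add: B)
    qed
    then show "S ** S = A" by (simp add: matrix_eq matrix_vector_mul_assoc[symmetric])
  qed
qed

lemma sym_pos_def_sqrt_unique:
  fixes S T :: "real^'k^'k"
  assumes S: "sym_pos_def S" and T: "sym_pos_def T" and eq: "S ** S = T ** T"
  shows "S = T"
proof -
  \<comment> \<open>\<open>S\<^sup>2 = T\<^sup>2\<close> makes \<open>X\<close> anticommute with \<open>W\<close>, so the positive semidefinite \<open>X W X\<close> has trace 0.\<close>
  define W where "W = S + T"
  define X where "X = S - T"
  have W: "sym_pos_def W"
    unfolding W_def using S T by (intro sym_pos_def_add sym_pos_defD)
  have "(W ** X + X ** W) *v x = 2 *\<^sub>R ((S ** S) *v x - (T ** T) *v x)" for x
    unfolding W_def X_def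
    by (simp add: matrix_vector_mul_assoc[symmetric] algebra_simps scaleR_2)
  then have WX: "W ** X + X ** W = 0"
    using eq by (simp add: matrix_eq)
  have X: "transpose X = X"
    using S T by (simp add: X_def transpose_def vec_eq_iff sym_pos_def_def)
  \<comment> \<open>By cyclicity both summands of \<open>(W X + X W) X\<close> have the trace of
    \<open>X W X\<close>, so twice that trace is 0.\<close>
  have "trace (X ** W ** X) = trace (X ** (W ** X))"
    by (simp add: matrix_mul_assoc)
  also have "\<dots> = trace ((W ** X) ** X)"
    by (rule trace_mul_sym)
  finally have 1: "trace (X ** W ** X) = trace ((W ** X) ** X)" .
  have 2: "(W ** X + X ** W) ** X = (W ** X) ** X + X ** W ** X"
    by (simp add: matrix_eq matrix_vector_mul_assoc[symmetric] algebra_simps)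
  have "trace (X ** W ** X) + trace (X ** W ** X) = trace ((W ** X + X ** W) ** X)"
    unfolding 2 trace_add using 1 by simp
  also have "\<dots> = 0" unfolding WX by (simp add: matrix_matrix_mult_def trace_def)
  finally have tr: "trace (X ** W ** X) = 0" by simp
  have XWX: "X ** W ** X = transpose X ** W ** X" by (simp add: X)
  have diag: "(X ** W ** X) $ i $ i = axis i 1 \<bullet> ((X ** W ** X) *v axis i 1)" for i
    by (simp add: matrix_vector_mult_basis column_def inner_axis' )
  \<comment> \<open>The diagonal entries are nonnegative with sum 0, so each vanishes; definiteness
    of \<open>W\<close> then makes \<open>X\<close> annihilate every basis vector.\<close>
  then have "(\<Sum>i\<in>UNIV. axis i 1 \<bullet> ((X ** W ** X) *v axis i 1)) = 0"
    using tr by (simp add: trace_def)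
  then have "axis i 1 \<bullet> ((X ** W ** X) *v axis i 1) = 0" for i
    using sym_pos_def_congruence(3)[OF W, of _ X] by (subst (asm) sum_nonneg_eq_0_iff) (auto simp: X)
  then have "X *v axis i 1 = 0" for i
    using sym_pos_def_congruence(4)[OF W, of "axis i 1" X] by (simp add: X)
  then have "X = 0"
    by (simp add: matrix_vector_mult_basis column_def vec_eq_iff)
  then show ?thesis by (simp add: X_def)
qed

lemma matrix_sqrt:
  assumes "sym_pos_def A"
  shows "sym_pos_def (matrix_sqrt A)" "matrix_sqrt A ** matrix_sqrt A = A"
proof -
  have "\<exists>!S. sym_pos_def S \<and> S ** S = A"
    using sym_pos_def_sqrt_exists[OF assms] sym_pos_def_sqrt_unique by metis
  from theI'[OF this] show "sym_pos_def (matrix_sqrt A)" "matrix_sqrt A ** matrix_sqrt A = A"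
    unfolding matrix_sqrt_def by auto
qed

section \<open>The least squares functional and the uninformative posterior\<close>

text \<open>The inverse of the root is symmetric and squares to \<open>matrix_inv \<Sigma>\<close>.
  From here on the square root no longer appears.\<close>

lemma least_squares_quadratic:
  assumes "sym_pos_def \<Sigma>"
  shows "2 * least_squares G \<Sigma> \<theta> y = (y - G *v \<theta>) \<bullet> (matrix_inv \<Sigma> *v (y - G *v \<theta>))"
proof -
  define R where "R = matrix_sqrt \<Sigma>"
  have R: "sym_pos_def R" "R ** R = \<Sigma>"
    using matrix_sqrt[OF assms] by (auto simp: R_def)
  note inv = sym_pos_def_invertible[OF R(1)]
  have "matrix_inv \<Sigma> = matrix_inv R ** matrix_inv R"
    by (rule matrix_inv_unique)
      (metis R(2) inv matrix_inv_mult(2) matrix_mul_assoc matrix_mul_rid)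
  then show ?thesis
    using sym_pos_defD(5)[OF sym_pos_def_matrix_inv[OF R(1)]]
    by (simp add: least_squares_def R_def[symmetric] power2_norm_eq_inner
        matrix_vector_mul_assoc[symmetric])
qed

text \<open>Expanding around \<open>\<theta>\<close>, the normal equations cancel the cross term,
  and what remains is a nonnegative quadratic form in the displacement \<open>d\<close>.\<close>

lemma least_squares_minimizer:
  fixes G :: "real^'n^'m"
  assumes S: "sym_pos_def \<Sigma>"
    and normal: "transpose G *v (matrix_inv \<Sigma> *v (y - G *v \<theta>)) = 0"
  shows "is_arg_min (\<lambda>\<theta>. least_squares G \<Sigma> \<theta> y) (\<lambda>\<theta>. True) \<theta>"
proof -
  note W = sym_pos_def_matrix_inv[OF S]
  have "least_squares G \<Sigma> \<theta> y \<le> least_squares G \<Sigma> z y" for z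
  proof -
    define d where "d = G *v (z - \<theta>)"
    define v where "v = y - G *v \<theta>"
    have "d \<bullet> (matrix_inv \<Sigma> *v v) = 0"
      unfolding d_def v_def by (metis inner_commute inner_matrix_vector_mult inner_zero_left normal)
    moreover have "y - G *v z = v - d"
      by (simp add: d_def v_def algebra_simps)
    ultimately have "2 * least_squares G \<Sigma> z y
        = 2 * least_squares G \<Sigma> \<theta> y + d \<bullet> (matrix_inv \<Sigma> *v d)"
      using sym_pos_defD(5)[OF W, of v d]
      unfolding least_squares_quadratic[OF S] v_def[symmetric]
      by (simp add: matrix_vector_mult_diff_distrib inner_diff_left inner_diff_right inner_commute)
    then show ?thesis using sym_pos_defD(3)[OF W, of d] by linarith
  qed
  then show ?thesis by (auto simp: is_arg_min_def not_less)
qed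

lemma precision_uninformative_posterior:
  fixes G :: "real^'n^'m"
  assumes S: "sym_pos_def \<Sigma>"
  shows "is_precision_matrix (uninformative_posterior G \<Sigma> y) (transpose G ** matrix_inv \<Sigma> ** G)"
proof -
  note W = sym_pos_def_matrix_inv[OF S]
  have "- 2 * ln (uninformative_posterior G \<Sigma> y \<theta>)
      = \<theta> \<bullet> ((transpose G ** matrix_inv \<Sigma> ** G) *v \<theta>)
        + (- 2 *\<^sub>R (transpose G *v (matrix_inv \<Sigma> *v y))) \<bullet> \<theta> + y \<bullet> (matrix_inv \<Sigma> *v y)" for \<theta>
  proof -
    have "(transpose G *v (matrix_inv \<Sigma> *v y)) \<bullet> \<theta> = (matrix_inv \<Sigma> *v y) \<bullet> (G *v \<theta>)"
      by (rule inner_matrix_vector_mult[symmetric])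
    moreover have "y \<bullet> (matrix_inv \<Sigma> *v (G *v \<theta>)) = (matrix_inv \<Sigma> *v y) \<bullet> (G *v \<theta>)"
      by (rule sym_pos_defD(5)[OF W])
    ultimately show ?thesis
      using least_squares_quadratic[OF S, of G \<theta> y]
      by (simp add: uninformative_posterior_def sym_pos_def_congruence(2)[OF W] algebra_simps inner_simps
          inner_commute del: transpose_matrix_vector)
  qed
  then show ?thesis
    unfolding is_precision_matrix_def
    by (intro conjI sym_pos_def_congruence(1)[OF W] exI[of _ "- 2 *\<^sub>R (transpose G *v (matrix_inv \<Sigma> *v y))"]
        exI[of _ "y \<bullet> (matrix_inv \<Sigma> *v y)"] allI) (simp_all add: uninformative_posterior_def)
qed

section \<open>The Kalman update in precision form\<close>

text \<open>This is the Woodbury identity, together with the action of the new precision on the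
  gain. The latter is proved first: it cancels the correction term when \<open>Q\<close> is applied
  to the new covariance.\<close>

lemma kalman_update:
  fixes G :: "real^'n^'m"
  assumes P: "sym_pos_def P" and N: "sym_pos_def N"
  defines "K \<equiv> P ** transpose G ** matrix_inv (G ** P ** transpose G + N)"
  shows "sym_pos_def (G ** P ** transpose G + N)"
    and "sym_pos_def (P - K ** G ** P)"
    and "matrix_inv (P - K ** G ** P) = matrix_inv P + transpose G ** matrix_inv N ** G"
    and "matrix_inv (P - K ** G ** P) *v (K *v v) = transpose G *v (matrix_inv N *v v)"
proof -
  define M where "M = G ** P ** transpose G + N"
  define Q where "Q = matrix_inv P + transpose G ** matrix_inv N ** G"
  have "sym_pos_def (N + transpose (transpose G) ** P ** transpose G)"
    by (intro sym_pos_def_add N sym_pos_def_congruence(1)[OF P] sym_pos_def_congruence(3)[OF P])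
  then show M: "sym_pos_def (G ** P ** transpose G + N)"
    by (simp add: add.commute)
  note Wi = sym_pos_def_matrix_inv[OF N]
  have Q: "sym_pos_def Q"
    unfolding Q_def
    by (intro sym_pos_def_add sym_pos_def_matrix_inv P sym_pos_def_congruence(1)[OF Wi] sym_pos_def_congruence(3)[OF Wi])
  note ips = matrix_inv_mult_vec[OF sym_pos_def_invertible[OF P]]
  note ins = matrix_inv_mult_vec[OF sym_pos_def_invertible[OF N]]
  note ims = matrix_inv_mult_vec[OF sym_pos_def_invertible[OF M], folded M_def]
  have Mv: "M *v x = G *v (P *v (transpose G *v x)) + N *v x" for x
    by (simp add: M_def matrix_vector_mul_assoc[symmetric] algebra_simps)
  have Kv: "K *v x = P *v (transpose G *v (matrix_inv M *v x))" for x
    by (simp add: K_def M_def matrix_vector_mul_assoc[symmetric] del: transpose_matrix_vector)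
  have Qv: "Q *v x = matrix_inv P *v x + transpose G *v (matrix_inv N *v (G *v x))" for x
    by (simp add: Q_def matrix_vector_mul_assoc[symmetric] algebra_simps
        del: transpose_matrix_vector)
  \<comment> \<open>With \<open>u\<close> the preimage of \<open>v\<close> under \<open>M\<close>,
    the factor \<open>transpose G *v (matrix_inv N *v _)\<close> can be pulled out of both terms of
    \<open>Q\<close>; its argument is \<open>M *v u = v\<close>.\<close>
  have QK: "Q *v (K *v v) = transpose G *v (matrix_inv N *v v)" for v
  proof -
    let ?u = "matrix_inv M *v v"
    have "Q *v (K *v v) = transpose G *v (matrix_inv N *v (N *v ?u + G *v (P *v (transpose G *v ?u))))"
      by (simp add: Qv Kv ips matrix_vector_right_distrib ins del: transpose_matrix_vector)
    also have "N *v ?u + G *v (P *v (transpose G *v ?u)) = v"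
      using Mv[of ?u] ims(1)[of v] by (simp add: add.commute)
    finally show ?thesis .
  qed
  have "Q *v ((P - K ** G ** P) *v x) = x" for x
    by (simp add: matrix_vector_mult_diff_rdistrib matrix_vector_mult_diff_distrib
        matrix_vector_mul_assoc[symmetric] QK del: transpose_matrix_vector)
      (simp add: Qv ips del: transpose_matrix_vector)
  then have QL: "Q ** (P - K ** G ** P) = mat 1"
    by (simp add: matrix_eq matrix_vector_mul_assoc[symmetric])
  \<comment> \<open>Definiteness of the new covariance, which is not visible from a difference,
    follows because it is the inverse of the definite matrix \<open>Q\<close>.\<close>
  then have "matrix_inv Q = P - K ** G ** P"
    by (intro matrix_inv_unique) (simp add: matrix_left_right_inverse)
  with sym_pos_def_matrix_inv[OF Q] show "sym_pos_def (P - K ** G ** P)"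
    by simp
  show inv: "matrix_inv (P - K ** G ** P) = matrix_inv P + transpose G ** matrix_inv N ** G"
    using matrix_inv_unique[OF QL] by (simp add: Q_def)
  show "matrix_inv (P - K ** G ** P) *v (K *v v) = transpose G *v (matrix_inv N *v v)"
    unfolding inv Q_def[symmetric] by (rule QK)
qed

section \<open>Exponential convergence of the precision and the mean\<close>

theorem theorem3p1:
  fixes G :: "real^'n^'m"
    and y :: "real^'m"
    and \<Sigma>\<^sub>\<eta> \<Sigma>\<^sub>\<nu> :: "real^'m^'m"
    and \<Sigma>\<^sub>\<omega> Chat C :: "nat \<Rightarrow> real^'n^'n"
    and m :: "nat \<Rightarrow> real^'n"
  assumes "sym_pos_def \<Sigma>\<^sub>\<eta>"
    and "sym_pos_def (C 0)"
    and "\<Sigma>\<^sub>\<nu> = 2 *\<^sub>R \<Sigma>\<^sub>\<eta>"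
    and "\<And>n. \<Sigma>\<^sub>\<omega> n = C n"
    and "\<And>n. Chat (Suc n) = C n + \<Sigma>\<^sub>\<omega> n"
    and "\<And>n. m (Suc n) = m n +
           (Chat (Suc n) ** transpose G **
             matrix_inv (G ** Chat (Suc n) ** transpose G + \<Sigma>\<^sub>\<nu>)) *v (y - G *v m n)"
    and "\<And>n. C (Suc n) = Chat (Suc n) -
           Chat (Suc n) ** transpose G **
             matrix_inv (G ** Chat (Suc n) ** transpose G + \<Sigma>\<^sub>\<nu>) ** G ** Chat (Suc n)"
  shows "(\<forall>n. invertible (G ** Chat (Suc n) ** transpose G + \<Sigma>\<^sub>\<nu>)) \<and>
         (\<forall>n. sym_pos_def (C n) \<and> invertible (C n)) \<and>
         (\<exists>m_inf P_inf.
            converges_exponentially m m_inf \<and>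
            converges_exponentially (\<lambda>n. matrix_inv (C n)) P_inf \<and>
            is_arg_min (\<lambda>\<theta>. least_squares G \<Sigma>\<^sub>\<eta> \<theta> y) (\<lambda>\<theta>. True) m_inf \<and>
            P_inf = transpose G ** matrix_inv \<Sigma>\<^sub>\<eta> ** G \<and>
            is_precision_matrix (uninformative_posterior G \<Sigma>\<^sub>\<eta> y) P_inf)"
  (is "?inv \<and> ?spd \<and> _")
proof -
  define W where "W = matrix_inv \<Sigma>\<^sub>\<eta>"
  define H where "H = transpose G ** W ** G"
  define D where "D = matrix_inv (C 0) - H"
  define e where "e n = (1/2::real) ^ n" for n
  have W: "sym_pos_def W"
    unfolding W_def by (rule sym_pos_def_matrix_inv[OF assms(1)])
  have Hv: "H *v x = transpose G *v (W *v (G *v x))" for x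
    by (simp add: H_def matrix_vector_mul_assoc[symmetric] del: transpose_matrix_vector)
  have N: "sym_pos_def \<Sigma>\<^sub>\<nu>"
    unfolding assms(3) by (intro sym_pos_def_scaleR assms(1)) simp
  have Ni: "matrix_inv \<Sigma>\<^sub>\<nu> = (1/2) *\<^sub>R W"
    unfolding assms(3) W_def by (intro matrix_inv_scaleR sym_pos_def_invertible assms(1)) simp
  have Chat: "Chat (Suc n) = 2 *\<^sub>R C n" for n
    by (simp add: assms(4,5) scaleR_2)
  have step: "sym_pos_def (Chat (Suc n))" if "sym_pos_def (C n)" for n
    unfolding Chat using that by (intro sym_pos_def_scaleR) auto
  have C: "sym_pos_def (C n)" for n
  proof (induction n)
    case (Suc n)
    then show ?case
      unfolding assms(7) by (intro kalman_update(2) step N)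
  qed (rule assms(2))
  note kalman = kalman_update[OF step[OF C] N, where G = G]
  \<comment> \<open>Both summands carry a factor 1/2: the old precision from doubling the
    covariance, and \<open>H\<close> from \<open>\<Sigma>\<^sub>\<nu>\<close> being twice
    \<open>\<Sigma>\<^sub>\<eta>\<close>.\<close>
  have PSuc: "matrix_inv (C (Suc n)) = (1/2) *\<^sub>R (matrix_inv (C n) + H)" for n
  proof -
    have "matrix_inv (C (Suc n)) = matrix_inv (Chat (Suc n)) + transpose G ** matrix_inv \<Sigma>\<^sub>\<nu> ** G"
      unfolding assms(7) by (rule kalman(3))
    also have "matrix_inv (Chat (Suc n)) = (1/2) *\<^sub>R matrix_inv (C n)"
      unfolding Chat by (intro matrix_inv_scaleR sym_pos_def_invertible C) simp
    finally show ?thesis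
      by (simp add: Ni H_def scaleR_add_right matrix_scalar_ac scalar_matrix_assoc[symmetric])
  qed
  have P: "matrix_inv (C n) = H + e n *\<^sub>R D" for n
  proof (induction n)
    case (Suc n)
    have "H = (1/2) *\<^sub>R (H + H)"
      by (simp add: scaleR_2[symmetric])
    with Suc show ?case
      by (simp add: PSuc e_def scaleR_add_right)
  qed (simp add: D_def e_def)

  define b where "b = transpose G *v (W *v (y - G *v m 0))"
  \<comment> \<open>Two uses of \<open>range_congruence\<close>: first the range of
    \<open>transpose G\<close> equals that of \<open>H\<close>, then, with \<open>C 0\<close> in the
    middle, that of \<open>H ** C 0 ** H\<close>.\<close>
  have "b \<in> range ((*v) H)"
    unfolding H_def range_congruence[OF W] b_def by blast
  also have "transpose H = H"
    unfolding H_def by (rule sym_pos_def_congruence(1)[OF W])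
  then have "range ((*v) H) = range ((*v) (H ** C 0 ** H))"
    using range_congruence[OF assms(2), of H] by simp
  finally obtain w where w: "b = H *v (C 0 *v (H *v w))"
    by (auto simp: matrix_vector_mul_assoc[symmetric])
  \<comment> \<open>Minimizers need not be unique; this one differs from \<open>m 0\<close> by an
    element of \<open>C 0\<close> times the range of \<open>H\<close>, so the initial weighted error
    is \<open>- (H *v w)\<close>.\<close>
  define m_inf where "m_inf = m 0 + C 0 *v (H *v w)"
  have normal: "transpose G *v (W *v (y - G *v m_inf)) = 0"
  proof -
    have "transpose G *v (W *v (y - G *v m_inf)) = b - H *v (C 0 *v (H *v w))"
      unfolding m_inf_def b_def Hv
      by (simp add: matrix_vector_right_distrib matrix_vector_mult_diff_distrib
          del: transpose_matrix_vector)
    then show ?thesis using w by simp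
  qed
  have err: "matrix_inv (C n) *v (m n - m_inf) = - (e n *\<^sub>R (H *v w))" for n
  proof (induction n)
    case 0
    show ?case
      using matrix_inv_mult_vec(2)[OF sym_pos_def_invertible[OF assms(2)], of "H *v w"]
      by (simp add: m_inf_def e_def matrix_vector_mult_diff_distrib[of _ 0, simplified])
  next
    case (Suc n)
    let ?d = "m n - m_inf"
    \<comment> \<open>The increment contributes \<open>-1/2 H ?d\<close>, which cancels the
      \<open>H\<close> part of the new precision applied to \<open>?d\<close>; half of the old
      weighted error remains.\<close>
    have "matrix_inv (C (Suc n)) *v (m (Suc n) - m n)
        = transpose G *v (matrix_inv \<Sigma>\<^sub>\<nu> *v (y - G *v m n))"
      using kalman(4)[of n "y - G *v m n"] by (simp only: assms(6,7) add_diff_cancel_left')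
    also have "\<dots> = (1/2) *\<^sub>R (transpose G *v (W *v (y - G *v m_inf - G *v ?d)))"
      by (simp add: Ni scaleR_matrix_vector_mult matrix_vector_mult_scaleR
          matrix_vector_mult_diff_distrib scaleR_diff_right del: transpose_matrix_vector)
    also have "transpose G *v (W *v (y - G *v m_inf - G *v ?d)) = - (H *v ?d)"
      by (subst matrix_vector_mult_diff_distrib, subst matrix_vector_mult_diff_distrib)
        (simp only: normal Hv diff_0)
    finally have "matrix_inv (C (Suc n)) *v (m (Suc n) - m n) + matrix_inv (C (Suc n)) *v ?d
        = (1/2) *\<^sub>R (matrix_inv (C n) *v ?d)"
      by (simp add: PSuc scaleR_matrix_vector_mult matrix_vector_mult_add_rdistrib
          scaleR_add_right)
    then show ?case
      by (simp add: matrix_vector_right_distrib[symmetric] Suc e_def)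
  qed
  obtain c where c: "0 < c" "\<And>x. c * (norm x)\<^sup>2 \<le> x \<bullet> (matrix_inv (C 0) *v x)"
    using sym_pos_def_coercive[OF sym_pos_def_matrix_inv[OF assms(2)]] by metis
  have e: "0 < e n" "e n \<le> 1" for n
    by (auto simp: e_def power_le_one)
  have bound: "norm (m n - m_inf) \<le> (norm (D *v w) / c + norm w) * e n" for n
  proof -
    \<comment> \<open>The shift by \<open>e n *\<^sub>R w\<close> cancels the first-order term
      \<open>- e n *\<^sub>R (H *v w)\<close>, leaving only a multiple of
      \<open>(e n)\<^sup>2\<close>.\<close>
    define u where "u = m n - m_inf + e n *\<^sub>R w"
    have "matrix_inv (C n) *v u = (e n)\<^sup>2 *\<^sub>R (D *v w)"
      unfolding u_def matrix_vector_right_distrib err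
      by (simp add: P matrix_vector_mult_add_rdistrib scaleR_matrix_vector_mult
          matrix_vector_mult_scaleR scaleR_add_right power2_eq_square)
    then have "u \<bullet> (matrix_inv (C n) *v u) = (e n)\<^sup>2 * (u \<bullet> (D *v w))"
      by simp
    also have "\<dots> \<le> (e n)\<^sup>2 * (norm u * norm (D *v w))"
      by (intro mult_left_mono norm_cauchy_schwarz) simp
    finally have upper: "u \<bullet> (matrix_inv (C n) *v u) \<le> (e n)\<^sup>2 * (norm u * norm (D *v w))" .
    \<comment> \<open>The precision is a convex combination of \<open>H\<close> and the initial
      precision, so its form is at least \<open>e n * c\<close> times the squared norm. This uses up
      one of the two factors \<open>e n\<close>; the other is the decay rate.\<close>
    have "matrix_inv (C n) *v u = (1 - e n) *\<^sub>R (H *v u) + e n *\<^sub>R (matrix_inv (C 0) *v u)"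
      by (simp add: P[of n] D_def matrix_vector_mult_add_rdistrib matrix_vector_mult_diff_rdistrib
          scaleR_matrix_vector_mult scaleR_diff_left scaleR_diff_right)
    then have "u \<bullet> (matrix_inv (C n) *v u)
        = (1 - e n) * (u \<bullet> (H *v u)) + e n * (u \<bullet> (matrix_inv (C 0) *v u))"
      by (simp add: inner_add_right)
    moreover have "0 \<le> (1 - e n) * (u \<bullet> (H *v u))"
      unfolding H_def using e by (intro mult_nonneg_nonneg sym_pos_def_congruence(3)[OF W]) simp
    moreover have "e n * (c * (norm u)\<^sup>2) \<le> e n * (u \<bullet> (matrix_inv (C 0) *v u))"
      using e[of n] by (intro mult_left_mono c(2)) simp
    ultimately have "e n * (c * (norm u)\<^sup>2) \<le> (e n)\<^sup>2 * (norm u * norm (D *v w))"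
      using upper by linarith
    then have "(e n * norm u) * (c * norm u) \<le> (e n * norm u) * (e n * norm (D *v w))"
      by (simp add: power2_eq_square mult_ac)
    then have "norm u = 0 \<or> c * norm u \<le> e n * norm (D *v w)"
      using e(1)[of n] by (auto simp: mult_le_cancel_left zero_less_mult_iff)
    then have "norm u \<le> norm (D *v w) / c * e n"
      using c(1) e(1)[of n] by (auto simp: field_simps)
    moreover have "norm (m n - m_inf) \<le> norm u + norm (e n *\<^sub>R w)"
      using norm_triangle_ineq4[of u "e n *\<^sub>R w"] by (simp add: u_def)
    ultimately show ?thesis
      using e(1)[of n] by (simp add: algebra_simps)
  qed
  have "?inv"
    using kalman(1) sym_pos_def_invertible by blast
  moreover have "?spd"
    using C sym_pos_def_invertible by blast
  moreover have "converges_exponentially m m_inf"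
    unfolding converges_exponentially_def using bound
    by (intro exI[of _ "norm (D *v w) / c + norm w"] exI[of _ "1/2"]) (simp add: e_def)
  moreover have "converges_exponentially (\<lambda>n. matrix_inv (C n)) H"
    unfolding converges_exponentially_def
    by (intro exI[of _ "norm D"] exI[of _ "1/2"]) (simp add: P e_def)
  moreover have "is_arg_min (\<lambda>\<theta>. least_squares G \<Sigma>\<^sub>\<eta> \<theta> y) (\<lambda>\<theta>. True) m_inf"
    using least_squares_minimizer[OF assms(1)] normal by (simp only: W_def)
  moreover have "is_precision_matrix (uninformative_posterior G \<Sigma>\<^sub>\<eta> y) H"
    unfolding H_def W_def by (rule precision_uninformative_posterior[OF assms(1)])
  ultimately show ?thesis
    unfolding H_def W_def by blast
qed

end
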